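(* Let $E^{c}=\bigoplus_{r\in\mathbb{Z}}A_r$ be the Grassmann algebra $E$ endowed with a central $\mathbb{Z}$-grading and let $E_d=A_{\overline0}\oplus A_{\overline1}$ be its induced $\mathbb{Z}_2$-grading. Let $I=T_2(E_d)$ and $J=\{f\in F\langle X|\mathbb{Z}\rangle\mid \pi(f)\in I\}$. Then $T_{\mathbb{Z}}(E^{c})=J$.
   Context: $F$ is a field of characteristic zero; all algebras are associative and unitary over $F$. $E$ is the infinite dimensional Grassmann algebra over $F$: $L$ is the vector space with basis $e_1,e_2,\ldots$, and $E$ has basis $B_E$ consisting of $1$ and all products $e_{i_1}\cdots e_{i_k}$ with $i_1<\cdots<i_k$, $k\ge 1$, with multiplication induced by $e_ie_j=-e_je_i$. For $w=e_{i_1}\cdots e_{i_k}\in B_E$, $\mathrm{supp}(w)=\{e_{i_1},\ldots,e_{i_k}\}$ and the length of $w$ is $k$; two such elements have disjoint supports if the sets are disjoint. A $\mathbb{Z}$-grading $E=\bigoplus_{r\in\mathbb{Z}}A_r$ is homogeneous if each $e_i$ is homogeneous, and of full support if $A_r\neq0$ for all $r\in\mathbb{Z}$. A central $\mathbb{Z}$-grading on $E$ is a homogeneous $\mathbb{Z}$-grading of full support such that, for every $h\in 2\mathbb{Z}$, $A_h$ contains infinitely many elements of $B_E$ of even length with pairwise disjoint supports. The induced $\mathbb{Z}_2$-grading is $E_d=A_{\overline0}\oplus A_{\overline1}$, where $A_{\overline0}=\bigoplus_{r\text{ even}}A_r$, $A_{\overline1}=\bigoplus_{r\text{ odd}}A_r$.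 For $G=\mathbb{Z}$ or $\mathbb{Z}_2$, $F\langle X|G\rangle$ is the free unitary associative algebra on the disjoint union of countably infinite sets of variables of degree $g$, $g\in G$, with the natural $G$-grading. $T_{\mathbb{Z}}(A)$ (resp. $T_2(A)$) is the set of graded polynomial identities of a $\mathbb{Z}$-graded (resp. $\mathbb{Z}_2$-graded) algebra $A$, i.e. polynomials vanishing under all substitutions of variables by elements of $A$ of the same degree. The map $\pi\colon F\langle X|\mathbb{Z}\rangle\to F\langle X|\mathbb{Z}_2\rangle$ is the homomorphism of free algebras reducing degrees of variables modulo $2$: it sends each variable of $\mathbb{Z}$-degree $n$ to a variable of $\mathbb{Z}_2$-degree $\overline n$ ($x_i^n\mapsto x_i^{\overline n}$), with the convention that distinct variables of $F\langle X|\mathbb{Z}\rangle$ are sent to distinct variables of $F\langle X|\mathbb{Z}_2\rangle$. *)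

theory Defs
  imports Complex_Main "HOL-Library.Countable_Set" "HOL-Library.FSet" "HOL-Library.Poly_Mapping" "HOL-Library.Z2"
begin

section \<open>Unital associative algebras\<close>

locale assoc_algebra = vector_space scale
  for scale :: "'f::field \<Rightarrow> 'a::ring_1 \<Rightarrow> 'a" +
  assumes scale_mult_left: "scale c x * y = scale c (x * y)"
    and scale_mult_right: "x * scale c y = scale c (x * y)"


section \<open>The free algebra\<close>

text \<open>
  Words in the letters \<open>'v\<close> form an additively written monoid under concatenation, so that
  \<open>'v fmonoid \<Rightarrow>\<^sub>0 'f\<close> with the convolution product of \<open>HOL-Library.Poly_Mapping\<close> is the free
  unital associative algebra on \<open>'v\<close>.
\<close>

typedef 'v fmonoid = "UNIV :: 'v list set"
  morphisms letters Word ..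

setup_lifting type_definition_fmonoid

instantiation fmonoid :: (type) monoid_add
begin
lift_definition zero_fmonoid :: "'a fmonoid" is "[]" .
lift_definition plus_fmonoid :: "'a fmonoid \<Rightarrow> 'a fmonoid \<Rightarrow> 'a fmonoid" is "(@)" .
instance by (standard; transfer; simp)
end

type_synonym ('v, 'f) free_algebra = "'v fmonoid \<Rightarrow>\<^sub>0 'f"

definition fvar :: "'v \<Rightarrow> ('v, 'f::field) free_algebra" where
  "fvar v = Poly_Mapping.single (Word [v]) 1"

definition fscale :: "'f::field \<Rightarrow> ('v, 'f) free_algebra \<Rightarrow> ('v, 'f) free_algebra" where
  "fscale c p = Poly_Mapping.single 0 c * p"

lemma poly_mapping_add_induct [case_names zero add_single]:
  assumes "P 0" and "\<And>x k c. P x \<Longrightarrow> P (x + Poly_Mapping.single k c)"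
  shows "P (x :: 'k \<Rightarrow>\<^sub>0 'b::comm_monoid_add)"
proof (induction x rule: update_induct)
  case const
  then show ?case by (rule assms)
next
  case (update f a b)
  have "Poly_Mapping.update a b f = f + Poly_Mapping.single a b"
    using update.hyps
    by (intro poly_mapping_eqI)
      (auto simp: lookup_update lookup_add lookup_single when_def in_keys_iff)
  then show ?case using assms(2)[OF update.IH] by simp
qed

text \<open>The algebra homomorphism out of the free algebra that extends \<open>\<phi>\<close> (universal property).\<close>

definition free_eval ::
    "('f::field \<Rightarrow> 'a::ring_1 \<Rightarrow> 'a) \<Rightarrow> ('v \<Rightarrow> 'a) \<Rightarrow> ('v, 'f) free_algebra \<Rightarrow> 'a" where
  "free_eval scale \<phi> f =
     (\<Sum>w\<in>Poly_Mapping.keys f. scale (Poly_Mapping.lookup f w) (prod_list (map \<phi> (letters w))))"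

lemma lookup_fscale [simp]:
  "Poly_Mapping.lookup (fscale c p) w = c * Poly_Mapping.lookup p w"
proof -
  have "Poly_Mapping.single 0 c * p = Poly_Mapping.map ((*) c) p"
    by (simp add: mult_map_scale_conv_mult)
  then show ?thesis
    by (simp add: fscale_def Poly_Mapping.map.rep_eq when_def)
qed

interpretation free_algebra: assoc_algebra "fscale :: 'f::field \<Rightarrow> ('v, 'f) free_algebra \<Rightarrow> _"
proof
  fix c :: 'f and x y :: "('v, 'f) free_algebra"
  show "fscale c x * y = fscale c (x * y)"
    by (simp add: fscale_def mult.assoc)
  have "x * Poly_Mapping.single 0 c = Poly_Mapping.single 0 c * x"
    by (induction x rule: poly_mapping_add_induct)
      (simp_all add: distrib_left distrib_right mult_single mult.commute)
  then show "x * fscale c y = fscale c (x * y)"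
    by (simp add: fscale_def flip: mult.assoc)
qed (auto intro!: poly_mapping_eqI simp: lookup_add algebra_simps)

context assoc_algebra
begin

lemma free_eval_superset:
  assumes "finite K" "Poly_Mapping.keys f \<subseteq> K"
  shows "free_eval scale \<phi> f =
    (\<Sum>w\<in>K. scale (Poly_Mapping.lookup f w) (prod_list (map \<phi> (letters w))))"
  unfolding free_eval_def
  by (rule sum.mono_neutral_left) (use assms in \<open>auto simp: in_keys_iff\<close>)

lemma free_eval_add: "free_eval scale \<phi> (f + g) = free_eval scale \<phi> f + free_eval scale \<phi> g"
proof -
  let ?K = "Poly_Mapping.keys f \<union> Poly_Mapping.keys g"
  have "Poly_Mapping.keys (f + g) \<subseteq> ?K" by (rule Poly_Mapping.keys_add)
  then show ?thesis
    by (simp add: free_eval_superset[of ?K] lookup_add scale_left_distrib sum.distrib)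
qed

lemma free_eval_single:
  "free_eval scale \<phi> (Poly_Mapping.single w c) = scale c (prod_list (map \<phi> (letters w)))"
  by (simp add: free_eval_superset[of "{w}"])

lemma free_eval_var [simp]: "free_eval scale \<phi> (fvar v) = \<phi> v"
  by (simp add: fvar_def free_eval_single Word_inverse)

lemma free_eval_one [simp]: "free_eval scale \<phi> 1 = 1"
  using free_eval_single[of \<phi> 0 1] by (simp add: zero_fmonoid.rep_eq)

lemma free_eval_fscale: "free_eval scale \<phi> (fscale c f) = scale c (free_eval scale \<phi> f)"
proof -
  have "Poly_Mapping.keys (fscale c f) \<subseteq> Poly_Mapping.keys f"
    by (auto simp: in_keys_iff)
  then show ?thesis
    by (simp add: free_eval_superset[of "Poly_Mapping.keys f"] scale_sum_right)
qed

lemma free_eval_mult: "free_eval scale \<phi> (f * g) = free_eval scale \<phi> f * free_eval scale \<phi> g"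
proof (induction f rule: poly_mapping_add_induct)
  case zero
  then show ?case by (simp add: free_eval_def)
next
  case (add_single f w c)
  have "free_eval scale \<phi> (Poly_Mapping.single w c * g)
      = free_eval scale \<phi> (Poly_Mapping.single w c) * free_eval scale \<phi> g"
  proof (induction g rule: poly_mapping_add_induct)
    case zero
    then show ?case by (simp add: free_eval_def)
  next
    case (add_single g u d)
    have "free_eval scale \<phi> (Poly_Mapping.single w c * Poly_Mapping.single u d)
        = free_eval scale \<phi> (Poly_Mapping.single w c) * free_eval scale \<phi> (Poly_Mapping.single u d)"
      by (simp add: mult_single free_eval_single plus_fmonoid.rep_eq scale_mult_left
          scale_mult_right mult.commute)
    with add_single show ?case by (simp only: distrib_left free_eval_add)
  qed
  with add_single show ?case by (simp only: distrib_right free_eval_add)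
qed

end


section \<open>The infinite dimensional Grassmann algebra\<close>

text \<open>
  The finite set \<open>{i\<^sub>1 < \<dots> < i\<^sub>k}\<close> indexes the basis element \<open>e\<^bsub>i1\<^esub> \<cdots> e\<^bsub>ik\<^esub>\<close>, the empty set
  indexing \<open>1\<close>.  The generators are numbered from \<open>0\<close>.
\<close>

typedef (overloaded) 'f grassmann = "UNIV :: (nat fset \<Rightarrow>\<^sub>0 'f::zero) set"
  morphisms coeffs Grassmann ..

setup_lifting type_definition_grassmann

text \<open>
  Moving the factors of \<open>e\<^sub>S e\<^sub>T\<close> into increasing order costs one sign for every inversion, and
  the product vanishes if \<open>S\<close> and \<open>T\<close> meet.
\<close>

definition gsign :: "nat fset \<Rightarrow> nat fset \<Rightarrow> 'f::ring_1" where
  "gsign S T =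
     (if S |\<inter>| T = {||} then (- 1) ^ card {(i, j). i |\<in>| S \<and> j |\<in>| T \<and> j < i} else 0)"

definition gmult :: "(nat fset \<Rightarrow>\<^sub>0 'f::ring_1) \<Rightarrow> (nat fset \<Rightarrow>\<^sub>0 'f) \<Rightarrow> (nat fset \<Rightarrow>\<^sub>0 'f)" where
  "gmult x y = (\<Sum>S\<in>Poly_Mapping.keys x. \<Sum>T\<in>Poly_Mapping.keys y.
     Poly_Mapping.single (S |\<union>| T)
       (gsign S T * (Poly_Mapping.lookup x S * Poly_Mapping.lookup y T)))"

lemma gmult_superset:
  assumes "finite K" "finite L" "Poly_Mapping.keys x \<subseteq> K" "Poly_Mapping.keys y \<subseteq> L"
  shows "gmult x y = (\<Sum>S\<in>K. \<Sum>T\<in>L. Poly_Mapping.single (S |\<union>| T)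
    (gsign S T * (Poly_Mapping.lookup x S * Poly_Mapping.lookup y T)))"
proof -
  have "gmult x y = (\<Sum>S\<in>Poly_Mapping.keys x. \<Sum>T\<in>L. Poly_Mapping.single (S |\<union>| T)
    (gsign S T * (Poly_Mapping.lookup x S * Poly_Mapping.lookup y T)))"
    unfolding gmult_def
    by (intro sum.cong refl sum.mono_neutral_left) (use assms in \<open>auto simp: in_keys_iff\<close>)
  also have "\<dots> = (\<Sum>S\<in>K. \<Sum>T\<in>L. Poly_Mapping.single (S |\<union>| T)
    (gsign S T * (Poly_Mapping.lookup x S * Poly_Mapping.lookup y T)))"
    by (intro sum.mono_neutral_left) (use assms in \<open>auto simp: in_keys_iff\<close>)
  finally show ?thesis .
qed

lemma gmult_add_left: "gmult (x + y) z = gmult x z + gmult y z"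
proof -
  let ?K = "Poly_Mapping.keys x \<union> Poly_Mapping.keys y"
  have "Poly_Mapping.keys (x + y) \<subseteq> ?K" by (rule Poly_Mapping.keys_add)
  then show ?thesis
    by (simp add: gmult_superset[of ?K "Poly_Mapping.keys z"] lookup_add algebra_simps
        single_add sum.distrib)
qed

lemma gmult_add_right: "gmult x (y + z) = gmult x y + gmult x z"
proof -
  let ?K = "Poly_Mapping.keys y \<union> Poly_Mapping.keys z"
  have "Poly_Mapping.keys (y + z) \<subseteq> ?K" by (rule Poly_Mapping.keys_add)
  then show ?thesis
    by (simp add: gmult_superset[of "Poly_Mapping.keys x" ?K] lookup_add algebra_simps
        single_add sum.distrib)
qed

lemma gmult_zero [simp]: "gmult 0 x = 0" "gmult x 0 = 0"
  by (simp_all add: gmult_def)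

lemma gmult_single:
  "gmult (Poly_Mapping.single S a) (Poly_Mapping.single T b)
     = Poly_Mapping.single (S |\<union>| T) (gsign S T * (a * b))"
  by (simp add: gmult_superset[of "{S}" "{T}"])

lemma finite_inversions: "finite {(i, j). i |\<in>| S \<and> j |\<in>| T \<and> (j::nat) < i}"
  by (rule finite_subset[of _ "fset S \<times> fset T"]) auto

lemma gsign_cocycle:
  "gsign S T * gsign (S |\<union>| T) U = (gsign T U * gsign S (T |\<union>| U) :: 'f::comm_ring_1)"
proof (cases "S |\<inter>| T = {||} \<and> S |\<inter>| U = {||} \<and> T |\<inter>| U = {||}")
  case True
  let ?I = "\<lambda>S T. {(i, j). i |\<in>| S \<and> j |\<in>| T \<and> (j::nat) < i}"
  have "?I (S |\<union>| T) U = ?I S U \<union> ?I T U" "?I S (T |\<union>| U) = ?I S T \<union> ?I S U"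
    by auto
  moreover have "?I S U \<inter> ?I T U = {}" "?I S T \<inter> ?I S U = {}"
    using True by auto
  ultimately have "card (?I (S |\<union>| T) U) = card (?I S U) + card (?I T U)"
    "card (?I S (T |\<union>| U)) = card (?I S T) + card (?I S U)"
    by (simp_all add: card_Un_disjoint finite_inversions)
  moreover have "(S |\<union>| T) |\<inter>| U = {||}" "S |\<inter>| (T |\<union>| U) = {||}"
    using True by (auto simp: finter_funion_distrib finter_funion_distrib2)
  ultimately show ?thesis
    using True by (simp add: gsign_def power_add mult_ac)
next
  case False
  then show ?thesis
    by (auto simp: gsign_def finter_funion_distrib finter_funion_distrib2)
qed

lemma gmult_assoc:
  "gmult (gmult x y) z = gmult x (gmult y (z :: nat fset \<Rightarrow>\<^sub>0 'f::comm_ring_1))"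
proof (induction x rule: poly_mapping_add_induct)
  case (add_single x S a)
  have "gmult (gmult (Poly_Mapping.single S a) y) z = gmult (Poly_Mapping.single S a) (gmult y z)"
  proof (induction y rule: poly_mapping_add_induct)
    case (add_single y T b)
    have "gmult (gmult (Poly_Mapping.single S a) (Poly_Mapping.single T b)) z
        = gmult (Poly_Mapping.single S a) (gmult (Poly_Mapping.single T b) z)"
    proof (induction z rule: poly_mapping_add_induct)
      case (add_single z U c)
      have "gsign (S |\<union>| T) U * (gsign S T * (a * b) * c)
          = gsign S T * gsign (S |\<union>| T) U * (a * b * c)"
        by (simp add: mult_ac)
      also have "\<dots> = gsign S (T |\<union>| U) * (a * (gsign T U * (b * c)))"
        by (simp add: gsign_cocycle mult_ac)
      finally show ?case
        using add_single by (simp add: gmult_add_right gmult_single funion_assoc)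
    qed simp
    with add_single show ?case by (simp add: gmult_add_right gmult_add_left)
  qed simp
  with add_single show ?case by (simp add: gmult_add_left)
qed simp

lemma gsign_empty [simp]: "gsign {||} S = 1" "gsign S {||} = 1"
  by (simp_all add: gsign_def)

lemma gmult_one:
  "gmult (Poly_Mapping.single {||} 1) x = x" "gmult x (Poly_Mapping.single {||} 1) = x"
  by (induction x rule: poly_mapping_add_induct)
    (simp_all add: gmult_add_left gmult_add_right gmult_single)

instantiation grassmann :: (comm_ring_1) ring_1
begin
lift_definition zero_grassmann :: "'a grassmann" is 0 .
lift_definition one_grassmann :: "'a grassmann" is "Poly_Mapping.single {||} 1" .
lift_definition plus_grassmann :: "'a grassmann \<Rightarrow> 'a grassmann \<Rightarrow> 'a grassmann" is "(+)" .
lift_definition uminus_grassmann :: "'a grassmann \<Rightarrow> 'a grassmann" is uminus .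
lift_definition minus_grassmann :: "'a grassmann \<Rightarrow> 'a grassmann \<Rightarrow> 'a grassmann" is "(-)" .
lift_definition times_grassmann :: "'a grassmann \<Rightarrow> 'a grassmann \<Rightarrow> 'a grassmann" is gmult .
instance
proof
  have "Poly_Mapping.single {||} 1 \<noteq> (0 :: nat fset \<Rightarrow>\<^sub>0 'a)"
    by (metis lookup_single_eq lookup_zero zero_neq_one)
  then show "(0 :: 'a grassmann) \<noteq> 1" by transfer simp
qed (transfer; simp add: algebra_simps gmult_assoc gmult_one gmult_add_left gmult_add_right)+
end

lift_definition gscale :: "'f::comm_ring_1 \<Rightarrow> 'f grassmann \<Rightarrow> 'f grassmann" is
  "\<lambda>c. Poly_Mapping.map ((*) c)" .

text \<open>The elements \<open>gmono S\<close> are the basis \<open>B\<^sub>E\<close>, with support \<open>S\<close> and length \<open>fcard S\<close>.\<close>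

lift_definition gmono :: "nat fset \<Rightarrow> 'f::comm_ring_1 grassmann" is
  "\<lambda>S. Poly_Mapping.single S 1" .

definition ggen :: "nat \<Rightarrow> 'f::comm_ring_1 grassmann" where
  "ggen i = gmono {|i|}"

lemma lookup_map_times [simp]:
  "Poly_Mapping.lookup (Poly_Mapping.map ((*) c) p) k = (c::'f::comm_ring_1) * Poly_Mapping.lookup p k"
  by (simp add: Poly_Mapping.map.rep_eq when_def)

lemma map_times_add:
  "Poly_Mapping.map ((*) (c::'f::comm_ring_1)) (x + y)
     = Poly_Mapping.map ((*) c) x + Poly_Mapping.map ((*) c) y"
  by (rule poly_mapping_eqI) (simp add: lookup_add algebra_simps)

lemma map_times_zero [simp]: "Poly_Mapping.map ((*) (c::'f::comm_ring_1)) 0 = 0"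
  by (rule poly_mapping_eqI) simp

lemma map_times_single:
  "Poly_Mapping.map ((*) (c::'f::comm_ring_1)) (Poly_Mapping.single k a) = Poly_Mapping.single k (c * a)"
  by (rule poly_mapping_eqI) (simp add: lookup_single when_def)

lemma gmult_scale:
  "gmult (Poly_Mapping.map ((*) (c::'f::comm_ring_1)) x) y = Poly_Mapping.map ((*) c) (gmult x y)"
  "gmult x (Poly_Mapping.map ((*) c) y) = Poly_Mapping.map ((*) c) (gmult x y)"
proof -
  have *: "gmult (Poly_Mapping.map ((*) c) (Poly_Mapping.single S a)) y
      = Poly_Mapping.map ((*) c) (gmult (Poly_Mapping.single S a) y)
    \<and> gmult (Poly_Mapping.single S a) (Poly_Mapping.map ((*) c) y)
      = Poly_Mapping.map ((*) c) (gmult (Poly_Mapping.single S a) y)" for S a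
    by (induction y rule: poly_mapping_add_induct)
      (simp_all add: gmult_add_right map_times_add map_times_single gmult_single
        mult.assoc mult.left_commute)
  show "gmult (Poly_Mapping.map ((*) c) x) y = Poly_Mapping.map ((*) c) (gmult x y)"
    "gmult x (Poly_Mapping.map ((*) c) y) = Poly_Mapping.map ((*) c) (gmult x y)"
    by (induction x rule: poly_mapping_add_induct) (simp_all add: gmult_add_left map_times_add map_times_single *[unfolded map_times_single])
qed

interpretation grassmann: assoc_algebra "gscale :: 'f::field \<Rightarrow> 'f grassmann \<Rightarrow> 'f grassmann"
proof
  fix a b :: 'f and x y :: "'f grassmann"
  show "gscale a (x + y) = gscale a x + gscale a y"
    by transfer (rule map_times_add)
  show "gscale (a + b) x = gscale a x + gscale b x"
    by transfer (rule poly_mapping_eqI, simp add: lookup_add algebra_simps)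
  show "gscale a (gscale b x) = gscale (a * b) x"
    by transfer (rule poly_mapping_eqI, simp add: mult_ac)
  show "gscale 1 x = x"
    by transfer (rule poly_mapping_eqI, simp)
  show "gscale a x * y = gscale a (x * y)" "x * gscale a y = gscale a (x * y)"
    by (transfer, rule gmult_scale)+
qed

lemma gmono_eq_iff [simp]: "gmono S = gmono T \<longleftrightarrow> S = T"
proof -
  have "S = T" if "Poly_Mapping.single S (1::'a) = Poly_Mapping.single T 1"
    using arg_cong[OF that, of Poly_Mapping.keys] by simp
  then show ?thesis by transfer auto
qed

lemma gmono_mult: "gmono S * gmono T = gscale (gsign S T) (gmono (S |\<union>| T))"
  by transfer (simp add: gmult_single map_times_single)

lemma ggen_anticommute: "ggen i * ggen j = - (ggen j * ggen i :: 'f::field_char_0 grassmann)"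
proof -
  have inv: "{(a, b). a |\<in>| {|i|} \<and> b |\<in>| {|j|} \<and> b < a} = (if j < i then {(i, j)} else {})"
    for i j :: nat
    by auto
  consider "i < j" | "i = j" | "j < i" by linarith
  then have "gsign {|i|} {|j|} = (- gsign {|j|} {|i|} :: 'f)"
    unfolding gsign_def inv by cases simp_all
  moreover have "{|i|} |\<union>| {|j|} = {|j|} |\<union>| {|i|}" by auto
  ultimately show ?thesis
    by (simp only: ggen_def gmono_mult grassmann.scale_minus_left)
qed

lemma gmono_empty: "gmono {||} = 1"
  by transfer simp

lemma gmono_eq_prod_list: "gmono S = prod_list (map ggen (sorted_list_of_fset S))"
proof (induction "fcard S" arbitrary: S)
  case 0
  then show ?case by (simp add: gmono_empty sorted_list_of_fset.rep_eq)
next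
  case (Suc n)
  then have ne: "S \<noteq> {||}" by (auto simp: fcard.rep_eq)
  define i where "i = Min (fset S)"
  define T where "T = S |-| {|i|}"
  have "fset S \<noteq> {}" using ne by (metis bot_fset.rep_eq fset_cong)
  then have i: "i |\<in>| S" "\<And>j. j |\<in>| S \<Longrightarrow> i \<le> j"
    using Min_in[of "fset S"] by (auto simp: i_def)
  have S: "S = finsert i T" and iT: "i |\<notin>| T"
    using i(1) by (auto simp: T_def)
  have less: "i < j" if "j |\<in>| T" for j
    using i(2)[of j] that by (auto simp: T_def order.order_iff_strict)
  have inv: "{(a, b). a |\<in>| {|i|} \<and> b |\<in>| T \<and> b < a} = {}"
    using less by force
  have "gsign {|i|} T = (1::'a)"
    using iT unfolding gsign_def inv by simp
  then have "gmono S = ggen i * (gmono T :: 'a grassmann)"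
    unfolding ggen_def S by transfer (simp add: gmult_single)
  moreover have "sorted_list_of_fset S = i # sorted_list_of_fset T"
    using less iT unfolding S sorted_list_of_fset.rep_eq
    by (simp add: insort_is_Cons order.strict_implies_order)
  moreover have "n = fcard T"
    using Suc.hyps(2) iT by (simp add: S fcard_finsert_disjoint)
  ultimately show ?case using Suc.hyps(1) by simp
qed


section \<open>Gradings and graded identities\<close>

definition is_grading ::
    "('f::field \<Rightarrow> 'a::ring_1 \<Rightarrow> 'a) \<Rightarrow> ('g::ab_group_add \<Rightarrow> 'a set) \<Rightarrow> bool" where
  "is_grading scale A \<longleftrightarrow>
     (\<forall>g. module.subspace scale (A g)) \<and>
     (\<forall>x. \<exists>!c. (\<forall>g. c g \<in> A g) \<and> finite {g. c g \<noteq> 0} \<and> x = (\<Sum>g | c g \<noteq> 0. c g)) \<and>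
     (\<forall>g h. \<forall>x\<in>A g. \<forall>y\<in>A h. x * y \<in> A (g + h))"

text \<open>
  The variable \<open>(g, i)\<close> of \<open>F\<langle>X|G\<rangle>\<close> is the \<open>i\<close>-th variable of degree \<open>g\<close>.
\<close>

definition graded_identities ::
    "('f::field \<Rightarrow> 'a::ring_1 \<Rightarrow> 'a) \<Rightarrow> ('g \<Rightarrow> 'a set) \<Rightarrow> ('g \<times> nat, 'f) free_algebra set" where
  "graded_identities scale A =
     {f. \<forall>\<phi>. (\<forall>g i. \<phi> (g, i) \<in> A g) \<longrightarrow> free_eval scale \<phi> f = 0}"

definition homogeneous_grading :: "(int \<Rightarrow> 'f::field grassmann set) \<Rightarrow> bool" where
  "homogeneous_grading A \<longleftrightarrow> is_grading gscale A \<and> (\<forall>i. \<exists>r. ggen i \<in> A r)"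

definition full_support :: "(int \<Rightarrow> 'f::field grassmann set) \<Rightarrow> bool" where
  "full_support A \<longleftrightarrow> (\<forall>r. A r \<noteq> {0})"

definition central_grading :: "(int \<Rightarrow> 'f::field grassmann set) \<Rightarrow> bool" where
  "central_grading A \<longleftrightarrow> homogeneous_grading A \<and> full_support A \<and>
     (\<forall>h. even h \<longrightarrow>
       (\<exists>W. infinite W \<and> (\<forall>S\<in>W. gmono S \<in> A h \<and> even (fcard S)) \<and>
            (\<forall>S\<in>W. \<forall>T\<in>W. S \<noteq> T \<longrightarrow> S |\<inter>| T = {||})))"

text \<open>
  The type \<^typ>\<open>bit\<close> is the group \<open>\<int>\<^sub>2\<close>, with \<^term>\<open>of_int :: int \<Rightarrow> bit\<close> as reduction modulo \<open>2\<close>.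
\<close>

lemma of_int_bit: "(of_int r :: bit) = (if even r then 0 else 1)"
  by (cases "even r") (auto elim!: evenE oddE)

definition induced_grading :: "(int \<Rightarrow> 'f::field grassmann set) \<Rightarrow> bit \<Rightarrow> 'f grassmann set" where
  "induced_grading A d = module.span gscale (\<Union>r\<in>{r. of_int r = d}. A r)"

text \<open>
  \<open>reduces_mod2 \<sigma>\<close>: on variables, \<open>\<sigma>\<close> reduces degrees modulo \<open>2\<close> and sends distinct variables to
  distinct variables.  Keeping the index, \<open>(n, i) \<mapsto> (of_int n, i)\<close>, would not be injective,
  hence the indices must change.
\<close>

definition reduces_mod2 :: "(int \<times> nat \<Rightarrow> bit \<times> nat) \<Rightarrow> bool" where
  "reduces_mod2 \<sigma> \<longleftrightarrow> inj \<sigma> \<and> (\<forall>n i. fst (\<sigma> (n, i)) = of_int n)"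

lemma reduces_mod2_exists: "\<exists>\<sigma>. reduces_mod2 \<sigma>"
proof
  have "inj (to_nat_on UNIV :: int \<times> nat \<Rightarrow> nat)"
    by (rule inj_on_to_nat_on) simp
  then show "reduces_mod2 (\<lambda>v. (of_int (fst v), to_nat_on UNIV v))"
    by (simp add: reduces_mod2_def inj_def)
qed

definition reduction_hom ::
    "(int \<times> nat \<Rightarrow> bit \<times> nat) \<Rightarrow>
     (int \<times> nat, 'f::field) free_algebra \<Rightarrow> (bit \<times> nat, 'f) free_algebra" where
  "reduction_hom \<sigma> = free_eval fscale (\<lambda>v. fvar (\<sigma> v))"

end

theory Submission
  imports Defs
begin

text \<open>
  That the reduction modulo \<open>2\<close> of \<open>f\<close> being an identity makes \<open>f\<close> an identity is formal: \<open>\<sigma>\<close> is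
  injective, so every \<open>\<int>\<close>-graded substitution factors through \<open>\<sigma>\<close> and a \<open>\<int>\<^sub>2\<close>-graded one.

  For the other inclusion, a graded identity \<open>f\<close> has to vanish also when a variable of degree \<open>n\<close>
  is replaced by a sum of elements whose degrees only have the parity of \<open>n\<close>.  Let \<open>b\<close> be one such
  summand, of degree \<open>r\<close>.  Since \<open>n - r\<close> is even, the central grading provides infinitely many even
  monomials of degree \<open>n - r\<close> with pairwise disjoint supports.  Their sums \<open>c\<close> are central, and
  \<open>b * c\<close> has the correct degree \<open>n\<close>.  So \<open>f\<close> vanishes if the variable is given the value \<open>a + b * c\<close>
  with \<open>a\<close> of degree \<open>n\<close>.  Because \<open>c\<close> is central, this value of \<open>f\<close> is a polynomial in \<open>c\<close>
  (\<open>central_poly_free_eval\<close>).  A polynomial that vanishes on all these \<open>c\<close> has only zero coefficients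
  (\<open>central_poly_vanishing\<close>; characteristic zero enters here), hence it also vanishes at the central
  element \<open>1\<close>, which turns \<open>a + b * c\<close> into \<open>a + b\<close>.  Adding one homogeneous summand of one variable
  after the other yields every substitution of the correct parity
  (\<open>graded_identity_parity_substitution\<close>).  Working with polynomials in \<open>c\<close> replaces the usual
  reduction to multilinear identities.
\<close>

section \<open>Evaluating elements of the free algebra\<close>

context assoc_algebra
begin

lemma free_eval_zero [simp]: "free_eval scale \<phi> 0 = 0"
  by (simp add: free_eval_def)

lemma free_eval_prod_list:
  "free_eval scale \<phi> (prod_list fs) = prod_list (map (free_eval scale \<phi>) fs)"
  by (induction fs) (simp_all add: free_eval_mult)

lemma free_eval_free_eval:
  "free_eval scale \<phi> (free_eval fscale \<theta> f) = free_eval scale (\<lambda>v. free_eval scale \<phi> (\<theta> v)) f"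
  by (induction f rule: poly_mapping_add_induct)
    (simp_all add: free_algebra.free_eval_add free_eval_add free_algebra.free_eval_single
      free_eval_single free_eval_fscale free_eval_prod_list comp_def
      assoc_algebra.free_eval_zero[OF free_algebra.assoc_algebra_axioms])

lemma free_eval_cong:
  assumes "\<And>w v. w \<in> Poly_Mapping.keys f \<Longrightarrow> v \<in> set (letters w) \<Longrightarrow> \<phi> v = \<psi> v"
  shows "free_eval scale \<phi> f = free_eval scale \<psi> f"
  unfolding free_eval_def
  by (intro sum.cong refl arg_cong2[where f = scale] arg_cong[where f = prod_list] map_cong assms)

end


section \<open>Polynomial functions of a central argument\<close>

definition central :: "'a::ring_1 \<Rightarrow> bool" where
  "central c \<longleftrightarrow> (\<forall>x. c * x = x * c)"

lemma central_0 [simp]: "central 0" and central_1 [simp]: "central 1"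
  by (simp_all add: central_def)

lemma central_add: "central c \<Longrightarrow> central d \<Longrightarrow> central (c + d)"
  by (simp add: central_def algebra_simps)

lemma central_power_commute: "central c \<Longrightarrow> c ^ k * x = x * c ^ k"
  by (induction k) (simp_all add: central_def mult.assoc, metis mult.assoc)

text \<open>
  The ring is not commutative, so only central arguments make these functions closed under
  products: powers of \<open>c\<close> have to be moved past the coefficients.
\<close>
definition central_poly :: "('a::ring_1 \<Rightarrow> 'a) \<Rightarrow> bool" where
  "central_poly F \<longleftrightarrow> (\<exists>n g. \<forall>c. central c \<longrightarrow> F c = (\<Sum>k<n. g k * c ^ k))"

lemma central_poly_monom: "central_poly (\<lambda>c. a * c ^ k)"
  unfolding central_poly_def
  by (intro exI[of _ "Suc k"] exI[of _ "\<lambda>j. if j = k then a else 0"])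
    (simp add: if_distrib[of "\<lambda>x. x * _"] sum.delta cong: if_cong)

lemma central_poly_add:
  assumes "central_poly F" "central_poly G"
  shows "central_poly (\<lambda>c. F c + G c)"
proof -
  obtain m g where g: "\<And>c. central c \<Longrightarrow> F c = (\<Sum>k<m. g k * c ^ k)"
    using assms(1) by (auto simp: central_poly_def)
  obtain n h where h: "\<And>c. central c \<Longrightarrow> G c = (\<Sum>k<n. h k * c ^ k)"
    using assms(2) by (auto simp: central_poly_def)
  have pad: "(\<Sum>k<l. u k * c ^ k) = (\<Sum>k<m + n. (if k < l then u k else 0) * c ^ k)"
    if "l \<le> m + n" for l u and c :: 'a
    by (rule sum.mono_neutral_cong_left) (use that in auto)
  show ?thesis
    unfolding central_poly_def
    by (intro exI[of _ "m + n"]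
        exI[of _ "\<lambda>k. (if k < m then g k else 0) + (if k < n then h k else 0)"])
      (simp add: g h pad[of m] pad[of n] distrib_right sum.distrib)
qed

lemma central_poly_sum:
  assumes "\<And>i. i \<in> I \<Longrightarrow> central_poly (F i)"
  shows "central_poly (\<lambda>c. \<Sum>i\<in>I. F i c)"
  using assms
proof (induction I rule: infinite_finite_induct)
  case (insert i I)
  then show ?case by (simp add: central_poly_add)
qed (use central_poly_monom[of 0 0] in simp_all)

lemma central_poly_cong:
  "central_poly F \<Longrightarrow> (\<And>c. central c \<Longrightarrow> F c = G c) \<Longrightarrow> central_poly G"
  by (auto simp: central_poly_def)

lemma central_poly_mult:
  assumes "central_poly F" "central_poly G"
  shows "central_poly (\<lambda>c. F c * G c)"
proof -
  obtain m g where g: "\<And>c. central c \<Longrightarrow> F c = (\<Sum>k<m. g k * c ^ k)"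
    using assms(1) by (auto simp: central_poly_def)
  obtain n h where h: "\<And>c. central c \<Longrightarrow> G c = (\<Sum>k<n. h k * c ^ k)"
    using assms(2) by (auto simp: central_poly_def)
  have "central_poly (\<lambda>c. \<Sum>k<m. \<Sum>j<n. g k * h j * c ^ (k + j))"
    by (intro central_poly_sum central_poly_monom)
  then show ?thesis
  proof (rule central_poly_cong)
    fix c :: 'a
    assume c: "central c"
    have "g k * c ^ k * (h j * c ^ j) = g k * h j * c ^ (k + j)" for k j
      using central_power_commute[OF c, of k "h j"] by (metis mult.assoc power_add)
    with c show "(\<Sum>k<m. \<Sum>j<n. g k * h j * c ^ (k + j)) = F c * G c"
      by (simp add: g h sum_product)
  qed
qed

text \<open>
  If \<open>c\<close> is central, then it can be moved past the letters of a word, so the value of every word,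
  and hence of \<open>f\<close>, can be sorted by powers of \<open>c\<close>.
\<close>
lemma (in assoc_algebra) central_poly_free_eval:
  "central_poly (\<lambda>c. free_eval scale (\<phi>(v := a + b * c)) f)"
proof -
  have letter: "central_poly (\<lambda>c. (\<phi>(v := a + b * c)) u)" for u
    using central_poly_add[OF central_poly_monom[of a 0] central_poly_monom[of b 1]]
      central_poly_monom[of "\<phi> u" 0]
    by (cases "u = v") simp_all
  have word: "central_poly (\<lambda>c. prod_list (map (\<phi>(v := a + b * c)) us))" for us
  proof (induction us)
    case Nil
    show ?case using central_poly_monom[of 1 0] by simp
  next
    case (Cons u us)
    then show ?case using central_poly_mult[OF letter[of u] Cons.IH] by simp
  qed
  have scale: "central_poly (\<lambda>c. scale d (F c))" if "central_poly F" for d F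
    using central_poly_mult[OF central_poly_monom[of "scale d 1" 0] that]
    by (simp add: scale_mult_left)
  show ?thesis
    unfolding free_eval_def by (intro central_poly_sum scale word)
qed


section \<open>Even monomials of the Grassmann algebra\<close>

text \<open>
  For disjoint \<open>S\<close> and \<open>T\<close>, each pair in \<open>S \<times> T\<close> is an inversion in exactly one of the two orders of
  multiplication, so both inversion numbers add up to \<open>fcard S * fcard T\<close>.
\<close>
lemma gsign_swap:
  "gsign T S = (- 1) ^ (fcard S * fcard T) * (gsign S T :: 'f::comm_ring_1)"
proof (cases "S |\<inter>| T = {||}")
  case True
  let ?I = "\<lambda>S T. {(i, j). i |\<in>| S \<and> j |\<in>| T \<and> (j::nat) < i}"
  have "fset S \<times> fset T = ?I S T \<union> prod.swap ` ?I T S"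
  proof (intro equalityI subsetI)
    fix p
    assume "p \<in> fset S \<times> fset T"
    then obtain i j where p: "p = (i, j)" "i |\<in>| S" "j |\<in>| T" by auto
    then have "i \<noteq> j" using True by auto
    then consider "j < i" | "i < j" by linarith
    then show "p \<in> ?I S T \<union> prod.swap ` ?I T S"
      using p by cases (auto simp: image_iff)
  qed auto
  moreover have "?I S T \<inter> prod.swap ` ?I T S = {}" by auto
  ultimately have "card (fset S \<times> fset T) = card (?I S T) + card (prod.swap ` ?I T S)"
    by (simp add: card_Un_disjoint finite_inversions)
  then have "fcard S * fcard T = card (?I S T) + card (?I T S)"
    by (simp add: card_cartesian_product fcard.rep_eq card_image)
  moreover have "T |\<inter>| S = {||}" using True by (simp add: finter_commute)
  ultimately show ?thesis
    using True by (simp add: gsign_def power_add mult_ac)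
next
  case False
  then show ?thesis by (simp add: gsign_def finter_commute)
qed

lemma gmult_even_commute:
  assumes "even (fcard S)"
  shows "gmult (Poly_Mapping.single S 1) x = gmult x (Poly_Mapping.single S (1 :: 'f::comm_ring_1))"
  by (induction x rule: poly_mapping_add_induct)
    (simp_all add: gmult_add_left gmult_add_right gmult_single gsign_swap[of _ S] assms
      funion_commute)

lemma central_gmono: "even (fcard S) \<Longrightarrow> central (gmono S)"
  unfolding central_def by (transfer, simp add: gmult_even_commute)

lemma gmono_square: "S \<noteq> {||} \<Longrightarrow> gmono S * gmono S = (0 :: 'f::field grassmann)"
  by (simp add: gmono_mult gsign_def)

definition gsupp :: "'f::zero grassmann \<Rightarrow> nat set" where
  "gsupp x = (\<Union>T\<in>Poly_Mapping.keys (coeffs x). fset T)"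

lemma finite_gsupp: "finite (gsupp x)"
  by (simp add: gsupp_def)

text \<open>
  For \<open>T\<close> disjoint from \<open>S\<close>, the map \<open>T \<mapsto> T |\<union>| S\<close> is injective.  So multiplying by the monomial of
  \<open>S\<close> moves the coefficients of \<open>x\<close> to different places, up to sign, and no cancellation is possible.
\<close>
lemma gmult_single_eq_0D:
  fixes x :: "nat fset \<Rightarrow>\<^sub>0 'f::comm_ring_1"
  assumes zero: "gmult x (Poly_Mapping.single S 1) = 0"
    and disj: "\<And>T. T \<in> Poly_Mapping.keys x \<Longrightarrow> T |\<inter>| S = {||}"
  shows "x = 0"
proof (rule ccontr)
  assume "x \<noteq> 0"
  then obtain U where U: "U \<in> Poly_Mapping.keys x"
    by (metis keys_eq_empty equals0I)
  have inj: "T |\<union>| S = U |\<union>| S \<longleftrightarrow> T = U" if "T \<in> Poly_Mapping.keys x" for T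
    using disj[OF that] disj[OF U] by blast
  have "0 = Poly_Mapping.lookup (gmult x (Poly_Mapping.single S 1)) (U |\<union>| S)"
    by (simp add: zero)
  also have "\<dots> = (\<Sum>T\<in>Poly_Mapping.keys x.
      if T = U then gsign U S * Poly_Mapping.lookup x U else 0)"
    by (subst gmult_superset[of "Poly_Mapping.keys x" "{S}"])
      (auto simp: lookup_sum lookup_single when_def inj intro!: sum.cong)
  also have "\<dots> = gsign U S * Poly_Mapping.lookup x U"
    using U by (simp add: sum.delta')
  finally have "gsign U S * (gsign U S * Poly_Mapping.lookup x U) = 0"
    by simp
  then show False
    using U disj[OF U] by (simp add: gsign_def in_keys_iff)
qed

lemma mult_gmono_eq_0D:
  assumes "x * gmono S = (0 :: 'f::comm_ring_1 grassmann)" and "gsupp x \<inter> fset S = {}"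
  shows "x = 0"
proof -
  have "T |\<inter>| S = {||}" if "T \<in> Poly_Mapping.keys (coeffs x)" for T
    using that assms(2) by (fastforce simp: gsupp_def)
  with assms(1) show ?thesis
    unfolding gsupp_def by transfer (rule gmult_single_eq_0D)
qed

text \<open>
  Each element of \<open>M\<close> lies in at most one member of \<open>W\<close>.  The empty set is avoided as well,
  because its monomial \<open>1\<close> does not square to zero.
\<close>
lemma disjoint_family_avoids_finite:
  fixes W :: "'a fset set"
  assumes "infinite W" and disj: "\<And>S T. S \<in> W \<Longrightarrow> T \<in> W \<Longrightarrow> S \<noteq> T \<Longrightarrow> S |\<inter>| T = {||}"
    and "finite M"
  obtains S where "S \<in> W" "S \<noteq> {||}" "M \<inter> fset S = {}"
proof -
  have "finite {S \<in> W. i |\<in>| S}" for i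
  proof (cases "\<exists>S\<in>W. i |\<in>| S")
    case True
    then obtain S where "S \<in> W" "i |\<in>| S" by blast
    then have "{S \<in> W. i |\<in>| S} \<subseteq> {S}" using disj by blast
    then show ?thesis by (rule finite_subset) simp
  next
    case False
    then have "{S \<in> W. i |\<in>| S} = {}" by blast
    then show ?thesis by (simp only: finite.emptyI)
  qed
  then have "finite ({{||}} \<union> (\<Union>i\<in>M. {S \<in> W. i |\<in>| S}))"
    using \<open>finite M\<close> by blast
  then obtain S where "S \<in> W" "S \<notin> {{||}} \<union> (\<Union>i\<in>M. {S \<in> W. i |\<in>| S})"
    using \<open>infinite W\<close> by (meson finite_subset subsetI)
  then show ?thesis using that by auto
qed


section \<open>Polynomials vanishing on sums of disjoint even monomials\<close>

text \<open>The binomial formula stops after the linear term in \<open>w\<close>.\<close>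
lemma (in assoc_algebra) power_add_square_zero:
  assumes "central w" "w * w = 0"
  shows "(c + w) ^ k = c ^ k + scale (of_nat k) (c ^ (k - 1) * w)"
proof (induction k)
  case (Suc k)
  have "(c + w) ^ Suc k = (c ^ k + scale (of_nat k) (c ^ (k - 1) * w)) * (c + w)"
    by (simp only: power_Suc2 Suc.IH)
  also have "\<dots> = c ^ k * c + c ^ k * w + scale (of_nat k) (c ^ (k - 1) * c * w)"
  proof -
    have "w * c = c * w" using assms(1) by (simp only: central_def)
    then have "c ^ (k - 1) * w * c = c ^ (k - 1) * c * w" "c ^ (k - 1) * w * w = 0"
      using assms(2) by (simp_all only: mult.assoc mult_zero_right)
    then show ?thesis
      by (simp only: distrib_left distrib_right scale_mult_left scale_zero_right
          add_0_right add_0_left add_ac)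
  qed
  also have "\<dots> = c ^ Suc k + scale (of_nat (Suc k)) (c ^ k * w)"
  proof -
    have "scale (of_nat k) (c ^ (k - 1) * c * w) = scale (of_nat k) (c ^ k * w)"
      by (cases k) (simp_all add: power_Suc2 del: power_Suc of_nat_Suc)
    then show ?thesis
      by (simp add: scale_left_distrib power_Suc2 add_ac del: power_Suc)
  qed
  finally show ?case by (simp only: diff_Suc_1)
qed simp

text \<open>
  Write \<open>p\<close> for the polynomial with coefficients \<open>g\<close> and \<open>p'\<close> for its formal derivative.  If \<open>w\<close> is
  the monomial of a nonempty member of \<open>W\<close>, then \<open>w\<close> is central with square zero, so that
  \<open>0 = p(c + w) = p(c) + p'(c) * w = p'(c) * w\<close>.  The value \<open>p'(c)\<close> has finite support, and \<open>w\<close> can be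
  chosen disjoint from it; therefore \<open>p'(c) = 0\<close>.  By induction on the degree, \<open>p'\<close> has zero
  coefficients, so in characteristic zero \<open>p\<close> is constant, and \<open>p(0) = 0\<close>.
\<close>
lemma central_poly_vanishing:
  fixes g :: "nat \<Rightarrow> 'f::field_char_0 grassmann"
  assumes W: "infinite W" "\<And>S T. S \<in> W \<Longrightarrow> T \<in> W \<Longrightarrow> S \<noteq> T \<Longrightarrow> S |\<inter>| T = {||}"
      "\<And>S. S \<in> W \<Longrightarrow> even (fcard S)"
    and C: "0 \<in> C" "\<And>c S. c \<in> C \<Longrightarrow> S \<in> W \<Longrightarrow> c + gmono S \<in> C"
    and zero: "\<And>c. c \<in> C \<Longrightarrow> (\<Sum>k<n. g k * c ^ k) = 0"
  shows "k < n \<Longrightarrow> g k = 0"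
  using zero
proof (induction n arbitrary: g k)
  case (Suc n)
  define g' where "g' k = gscale (of_nat (Suc k)) (g (Suc k))" for k
  have "(\<Sum>k<n. g' k * c ^ k) = 0" if c: "c \<in> C" for c
  proof -
    let ?y = "\<Sum>k<n. g' k * c ^ k"
    obtain S where S: "S \<in> W" "S \<noteq> {||}" "gsupp ?y \<inter> fset S = {}"
      using disjoint_family_avoids_finite[OF W(1,2) finite_gsupp[of ?y]] by blast
    let ?w = "gmono S :: 'f grassmann"
    have "0 = (\<Sum>k<Suc n. g k * (c + ?w) ^ k)"
      using Suc.prems(2) C(2)[OF c S(1)] by simp
    also have "\<dots> = (\<Sum>k<Suc n. g k * c ^ k)
        + (\<Sum>k<Suc n. gscale (of_nat k) (g k) * c ^ (k - 1) * ?w)"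
      by (simp only: grassmann.power_add_square_zero[OF central_gmono[OF W(3)[OF S(1)]]
            gmono_square[OF S(2)]] distrib_left sum.distrib grassmann.scale_mult_left
          grassmann.scale_mult_right mult.assoc)
    also have "(\<Sum>k<Suc n. g k * c ^ k) = 0"
      using Suc.prems(2) c by blast
    also have "(\<Sum>k<Suc n. gscale (of_nat k) (g k) * c ^ (k - 1) * ?w) = ?y * ?w"
      by (subst sum.lessThan_Suc_shift) (simp add: g'_def sum_distrib_right)
    finally have "?y * ?w = 0" by simp
    then show "?y = 0" using S(3) by (rule mult_gmono_eq_0D)
  qed
  then have "g' k = 0" if "k < n" for k
    using Suc.IH that by blast
  then have pos: "g (Suc k) = 0" if "k < n" for k
    using that by (simp add: g'_def del: of_nat_Suc)
  have "0 = (\<Sum>k<Suc n. g k * 0 ^ k)"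
    using Suc.prems(2)[OF C(1)] by simp
  also have "\<dots> = g 0"
    by (subst sum.lessThan_Suc_shift) simp
  finally show ?case
    using pos Suc.prems(1) by (cases k) auto
qed simp


section \<open>Graded identities\<close>

text \<open>
  Setting \<open>c = 1\<close> is legitimate although \<open>1\<close> need not have degree \<open>h\<close>, because the hypothesis forces all
  coefficients of the polynomial in \<open>c\<close> to vanish.
\<close>
lemma central_grading_replace_component:
  fixes A :: "int \<Rightarrow> 'f::field_char_0 grassmann set"
  assumes "central_grading A" "even h"
    and zero: "\<And>c. c \<in> A h \<Longrightarrow> free_eval gscale (\<phi>(v := a + b * c)) f = 0"
  shows "free_eval gscale (\<phi>(v := a + b)) f = 0"
proof -
  have sub: "grassmann.subspace (A h)"
    using assms(1) by (simp add: central_grading_def homogeneous_grading_def is_grading_def)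
  obtain W where "infinite W" and mono: "\<forall>S\<in>W. gmono S \<in> A h \<and> even (fcard S)"
    and disj: "\<forall>S\<in>W. \<forall>T\<in>W. S \<noteq> T \<longrightarrow> S |\<inter>| T = {||}"
    using assms(1,2) by (simp only: central_grading_def) metis
  obtain n g where g:
    "\<And>c. central c \<Longrightarrow> free_eval gscale (\<phi>(v := a + b * c)) f = (\<Sum>k<n. g k * c ^ k)"
    using grassmann.central_poly_free_eval[of \<phi> v a b f] unfolding central_poly_def by blast
  have "g k = 0" if "k < n" for k
  proof (rule central_poly_vanishing[of W "A h \<inter> Collect central"])
    show "0 \<in> A h \<inter> Collect central"
      using grassmann.subspace_0[OF sub] by simp
    show "c + gmono S \<in> A h \<inter> Collect central"
      if "c \<in> A h \<inter> Collect central" "S \<in> W" for c S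
      using that mono by (auto intro: grassmann.subspace_add[OF sub] central_add central_gmono)
    show "(\<Sum>k<n. g k * c ^ k) = 0" if "c \<in> A h \<inter> Collect central" for c
      using that g zero by (metis IntE mem_Collect_eq)
  qed (use that \<open>infinite W\<close> mono disj in simp_all)
  with g[of 1] show ?thesis by simp
qed

text \<open>
  The set \<open>K\<close> contains the variables for which only the parity of the degree is respected; it
  grows by one variable at a time.
\<close>
lemma graded_identity_parity_substitution:
  fixes A :: "int \<Rightarrow> 'f::field_char_0 grassmann set"
  assumes central: "central_grading A"
    and f: "f \<in> graded_identities gscale A"
    and "finite K"
    and \<phi>: "\<And>n i. \<phi> (n, i) \<in> (if (n, i) \<in> K then induced_grading A (of_int n) else A n)"
  shows "free_eval gscale \<phi> f = 0"
  using \<open>finite K\<close> \<phi>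
proof (induction K arbitrary: \<phi> rule: finite_induct)
  case empty
  then show ?case using f by (simp add: graded_identities_def)
next
  case (insert v K)
  have sub: "grassmann.subspace (A n)" for n
    using central by (simp add: central_grading_def homogeneous_grading_def is_grading_def)
  have mult: "x * y \<in> A (r + s)" if "x \<in> A r" "y \<in> A s" for x y r s
    using central that by (simp add: central_grading_def homogeneous_grading_def is_grading_def)
  obtain n i where v: "v = (n, i)" by fastforce
  \<comment> \<open>The summand \<open>a\<close> is arbitrary because it must absorb the elements \<open>b * c\<close> of degree \<open>n\<close>
    when a further component \<open>b\<close> is added to \<open>x\<close>.\<close>
  have "\<forall>a\<in>A n. free_eval gscale (\<phi>(v := a + x)) f = 0"
    if "x \<in> grassmann.span (\<Union>r\<in>{r. of_int r = (of_int n :: bit)}. A r)" for x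
    using that
  proof (induction rule: grassmann.span_induct_alt)
    case base
    have "free_eval gscale (\<phi>(v := a)) f = 0" if "a \<in> A n" for a
    proof (rule insert.IH)
      fix m j
      show "(\<phi>(v := a)) (m, j) \<in> (if (m, j) \<in> K then induced_grading A (of_int m) else A m)"
        using that insert.hyps insert.prems[of m j] v by auto
    qed
    then show ?case by (metis add.right_neutral)
  next
    case (step d b x)
    obtain r where r: "of_int r = (of_int n :: bit)" "b \<in> A r"
      using step.hyps(1) by auto
    show ?case
    proof
      fix a
      assume a: "a \<in> A n"
      have "free_eval gscale (\<phi>(v := (a + x) + gscale d b)) f = 0"
      proof (rule central_grading_replace_component[OF central])
        show "even (n - r)"
          using r(1) by (auto simp: of_int_bit split: if_splits)
        fix c
        assume "c \<in> A (n - r)"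
        then have "gscale d b * c \<in> A n"
          using mult[OF grassmann.subspace_scale[OF sub r(2), of d], of c "n - r"] by simp
        then have "a + gscale d b * c \<in> A n"
          using a by (simp add: grassmann.subspace_add[OF sub])
        with step.IH have "free_eval gscale (\<phi>(v := (a + gscale d b * c) + x)) f = 0"
          by (rule bspec)
        then show "free_eval gscale (\<phi>(v := (a + x) + gscale d b * c)) f = 0"
          by (simp only: add_ac)
      qed
      then show "free_eval gscale (\<phi>(v := a + (gscale d b + x))) f = 0"
        by (simp only: add_ac)
    qed
  qed
  moreover have "\<phi> v \<in> grassmann.span (\<Union>r\<in>{r. of_int r = (of_int n :: bit)}. A r)"
    using insert.prems[of n i] by (simp add: v induced_grading_def)
  ultimately have "free_eval gscale (\<phi>(v := 0 + \<phi> v)) f = 0"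
    using grassmann.subspace_0[OF sub, of n] by blast
  then show ?case by simp
qed

theorem corollary5p7:
  fixes A :: "int \<Rightarrow> 'f::field_char_0 grassmann set"
    and \<sigma> :: "int \<times> nat \<Rightarrow> bit \<times> nat"
  assumes "central_grading A"
    and "reduces_mod2 \<sigma>"
  shows "graded_identities gscale A =
    {f. reduction_hom \<sigma> f \<in> graded_identities gscale (induced_grading A)}"
proof -
  have inj: "inj \<sigma>" and deg: "fst (\<sigma> (n, i)) = of_int n" for n i
    using assms(2) by (simp_all add: reduces_mod2_def)
  have sub: "grassmann.subspace (A n)" for n
    using assms(1) by (simp add: central_grading_def homogeneous_grading_def is_grading_def)
  have eval: "free_eval gscale \<psi> (reduction_hom \<sigma> f) = free_eval gscale (\<lambda>v. \<psi> (\<sigma> v)) f"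
    for \<psi> and f :: "(int \<times> nat, 'f) free_algebra"
    by (simp add: reduction_hom_def grassmann.free_eval_free_eval)
  show ?thesis
  proof (intro equalityI subsetI CollectI)
    fix f
    assume f: "f \<in> graded_identities gscale A"
    show "reduction_hom \<sigma> f \<in> graded_identities gscale (induced_grading A)"
      unfolding graded_identities_def
    proof (intro CollectI allI impI)
      fix \<psi> :: "bit \<times> nat \<Rightarrow> 'f grassmann"
      assume \<psi>: "\<forall>g i. \<psi> (g, i) \<in> induced_grading A g"
      define K where "K = (\<Union>w\<in>Poly_Mapping.keys f. set (letters w))"
      \<comment> \<open>Only the variables occurring in \<open>f\<close> are relaxed, which keeps \<open>K\<close> finite; the others
        receive the value \<open>0\<close>, which is homogeneous of every degree.\<close>
      define \<phi> where "\<phi> v = (if v \<in> K then \<psi> (\<sigma> v) else 0)" for v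
      have "free_eval gscale \<phi> f = 0"
      proof (rule graded_identity_parity_substitution[OF assms(1) f])
        show "finite K" by (simp add: K_def)
        show "\<phi> (n, i) \<in> (if (n, i) \<in> K then induced_grading A (of_int n) else A n)" for n i
          using \<psi> deg[of n i] grassmann.subspace_0[OF sub, of n]
          by (metis \<phi>_def prod.collapse)
      qed
      moreover have "free_eval gscale \<phi> f = free_eval gscale (\<lambda>v. \<psi> (\<sigma> v)) f"
        by (rule grassmann.free_eval_cong) (auto simp: \<phi>_def K_def)
      ultimately show "free_eval gscale \<psi> (reduction_hom \<sigma> f) = 0"
        by (simp add: eval)
    qed
  next
    fix f
    assume "f \<in> {f. reduction_hom \<sigma> f \<in> graded_identities gscale (induced_grading A)}"
    then have f: "free_eval gscale \<psi> (reduction_hom \<sigma> f) = 0"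
      if "\<forall>g i. \<psi> (g, i) \<in> induced_grading A g" for \<psi>
      using that by (simp add: graded_identities_def)
    show "f \<in> graded_identities gscale A"
      unfolding graded_identities_def
    proof (intro CollectI allI impI)
      fix \<phi> :: "int \<times> nat \<Rightarrow> 'f grassmann"
      assume \<phi>: "\<forall>g i. \<phi> (g, i) \<in> A g"
      define \<psi> where "\<psi> u = (if u \<in> range \<sigma> then \<phi> (inv \<sigma> u) else 0)" for u
      have "\<psi> (g, i) \<in> induced_grading A g" for g i
      proof (cases "(g, i) \<in> range \<sigma>")
        case True
        then obtain n j where nj: "\<sigma> (n, j) = (g, i)" by (metis imageE surj_pair)
        then have "\<psi> (g, i) = \<phi> (n, j)"
          using inj by (auto simp: \<psi>_def inv_f_f simp flip: nj)
        moreover have "of_int n = g"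
          using deg[of n j] nj by simp
        ultimately show ?thesis
          using \<phi> by (auto simp: induced_grading_def intro!: grassmann.span_base)
      next
        case False
        then show ?thesis
          by (simp add: \<psi>_def induced_grading_def grassmann.span_zero)
      qed
      then have "free_eval gscale (\<lambda>v. \<psi> (\<sigma> v)) f = 0"
        using f[of \<psi>] by (simp add: eval)
      then show "free_eval gscale \<phi> f = 0"
        by (simp add: \<psi>_def inj)
    qed
  qed
qed

end
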